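(* Let $M$ be a lattice of rank $n$ and $\mathcal{A}_0,\dots,\mathcal{A}_n\subset M$ finite supports with generic polynomials $F_i=\sum_{a\in\mathcal{A}_i}u_{i,a}\chi^a$, and let $\mathrm{Res}_{\mathcal{A}}$ be their sparse resultant. Let $S(\rho)$ be a tight coherent mixed subdivision of $\Delta$ with $\mathcal{B}$, $\mathcal{H}_{\mathcal{A},\rho}$, $\mathcal{E}_{\mathcal{A},\rho}$ as in the context, and suppose the Canny–Emiris formula holds for $S(\rho)$, i.e. $\mathrm{Res}_{\mathcal{A}}=\det(\mathcal{H}_{\mathcal{A},\rho})/\det(\mathcal{E}_{\mathcal{A},\rho})$. Let $\mathcal{H}_{\mathcal{G}}$ and $\mathcal{E}_{\mathcal{G}}$ be the matrices produced by the greedy algorithm started from the lattice points in translated mixed cells. Then $\mathrm{Res}_{\mathcal{A}}=\det(\mathcal{H}_{\mathcal{G}})/\det(\mathcal{E}_{\mathcal{G}})$.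
   Context: $\Delta_i=\mathrm{conv}(\mathcal{A}_i)$, $\Delta=\sum_i\Delta_i\subset M_{\mathbb{R}}$. Sparse resultant: a primitive polynomial in $\mathbb{Z}[u_{i,a}]$ defining the direct image under the projection $\mathbb{T}_N\times\prod_i\mathbb{P}^{\mathcal{A}_i}\to\prod_i\mathbb{P}^{\mathcal{A}_i}$ of the incidence variety $\{F_0=\dots=F_n=0\}$. A lifting induces a coherent mixed subdivision $S(\rho)$ whose cells have components $D=D_0+\dots+D_n$; tight means $\sum_i\dim D_i=n$ for every $n$-cell. Fix generic $\delta\in M_{\mathbb{R}}$ such that every point of $\mathcal{B}=(\Delta+\delta)\cap M$ lies in the interior of a translated $n$-cell $D+\delta$. For such $b$: $t_{b,i}=\dim D_i$, $i(b)=\max\{i:t_{b,i}=0\}$, $a(b)$ the point $D_{i(b)}$. An $n$-cell is mixed if exactly one component is $0$-dimensional, non-mixed otherwise. $\mathcal{H}_{\mathcal{A},\rho}$ has rows and columns indexed by $\mathcal{B}$ with entry $[b,b']=u_{i(b),b'-b+a(b)}$ if $b'-b+a(b)\in\mathcal{A}_{i(b)}$, and $0$ otherwise; for $\mathcal{C}\subseteq\mathcal{B}$, $\mathcal{H}_{\mathcal{A},\rho,\mathcal{C}}$ is the principal submatrix indexed by $\mathcal{C}$. $\mathcal{B}^\circ$ is the set of points of $\mathcal{B}$ in translated non-mixed cells and $\mathcal{E}_{\mathcal{A},\rho}=\mathcal{H}_{\mathcal{A},\rho,\mathcal{B}^\circ}$. Greedy algorithm: start with the set $R$ of points of $\mathcal{B}$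 in translated mixed cells and repeatedly add, for each $b\in R$, all points of $b-a(b)+\mathcal{A}_{i(b)}$ (these lie in $\mathcal{B}$) until stable, obtaining $\mathcal{G}$; then $\mathcal{H}_{\mathcal{G}}=\mathcal{H}_{\mathcal{A},\rho,\mathcal{G}}$ and $\mathcal{E}_{\mathcal{G}}=\mathcal{H}_{\mathcal{A},\rho,\mathcal{G}\cap\mathcal{B}^\circ}$. *)

theory Defs
  imports "HOL-Analysis.Analysis" "HOL-Library.Poly_Mapping" "HOL-Library.Set_Algebras"
    "HOL-Combinatorics.Permutations"
begin

text \<open>The real vector space \<open>M\<^sub>\<real>\<close> is the type \<open>'v\<close>, and \<open>M\<close> is the set of integral combinations of
  an \<open>\<real>\<close>-basis of \<open>'v\<close>. The norm of \<open>'v\<close> only serves to speak about interiors; all norms on a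
  finite-dimensional space give the same ones.\<close>

definition lattice_of_rank :: "nat \<Rightarrow> 'v::real_vector set \<Rightarrow> bool" where
  "lattice_of_rank n M \<longleftrightarrow>
    (\<exists>E. finite E \<and> independent E \<and> span E = UNIV \<and> card E = n \<and>
         M = range (\<lambda>c::'v \<Rightarrow> int. \<Sum>e\<in>E. of_int (c e) *\<^sub>R e))"


section \<open>The coefficient ring\<close>

text \<open>The pair \<open>(i, a)\<close> is the index of the variable \<open>u\<^sub>i\<^sub>,\<^sub>a\<close>. The type has variables for all
  pairs; elements of \<open>\<int>[u\<^sub>i\<^sub>,\<^sub>a | i \<le> n, a \<in> \<A>\<^sub>i]\<close> are singled out by \<open>multiform\<close> below.\<close>

type_synonym ('v, 'c) upoly = "((nat \<times> 'v) \<Rightarrow>\<^sub>0 nat) \<Rightarrow>\<^sub>0 'c"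

definition uvar :: "nat \<Rightarrow> 'v \<Rightarrow> ('v, int) upoly" where
  "uvar i a = Poly_Mapping.single (Poly_Mapping.single (i, a) 1) 1"

definition peval :: "('v, complex) upoly \<Rightarrow> (nat \<times> 'v \<Rightarrow> complex) \<Rightarrow> complex" where
  "peval p u = (\<Sum>m\<in>Poly_Mapping.keys p.
     Poly_Mapping.lookup p m * (\<Prod>x\<in>Poly_Mapping.keys m. u x ^ Poly_Mapping.lookup m x))"

definition complexify :: "('v, int) upoly \<Rightarrow> ('v, complex) upoly" where
  "complexify p = Poly_Mapping.map of_int p"

definition primitive :: "('v, int) upoly \<Rightarrow> bool" where
  "primitive p \<longleftrightarrow> Gcd (range (Poly_Mapping.lookup p)) = 1"

text \<open>Multihomogeneous polynomials in the variables \<open>u\<^sub>i\<^sub>,\<^sub>a\<close> with \<open>i \<le> n\<close> and \<open>a \<in> A i\<close>, homogeneous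
  of degree \<open>d i\<close> in the \<open>i\<close>-th group.\<close>

definition multiform :: "nat \<Rightarrow> (nat \<Rightarrow> 'v set) \<Rightarrow> ('v, 'c::zero) upoly \<Rightarrow> bool" where
  "multiform n A p \<longleftrightarrow>
    (\<forall>m\<in>Poly_Mapping.keys p. Poly_Mapping.keys m \<subseteq> (SIGMA i:{..n}. A i)) \<and>
    (\<exists>d. \<forall>m\<in>Poly_Mapping.keys p. \<forall>i\<le>n. (\<Sum>a\<in>A i. Poly_Mapping.lookup m (i, a)) = d i)"

text \<open>\<open>r = p / q\<close> in the field of fractions of the integral domain \<open>\<int>[u]\<close>.\<close>

definition equals_quotient :: "'a::comm_ring_1 \<Rightarrow> 'a \<Rightarrow> 'a \<Rightarrow> bool" where
  "equals_quotient r p q \<longleftrightarrow> q \<noteq> 0 \<and> p = r * q"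


section \<open>The sparse resultant\<close>

text \<open>Points of \<open>\<Prod>\<^sub>i \<P>\<^sup>A\<^sup>i\<close> over \<open>\<complex>\<close> are represented by their homogeneous coordinates; all sets of
  such points below are unions of full classes of homogeneous coordinates. The values of \<open>u\<close>
  outside \<open>SIGMA i:{..n}. A i\<close> are irrelevant.\<close>

definition multiproj :: "nat \<Rightarrow> (nat \<Rightarrow> 'v set) \<Rightarrow> (nat \<times> 'v \<Rightarrow> complex) set" where
  "multiproj n A = {u. \<forall>i\<le>n. \<exists>a\<in>A i. u (i, a) \<noteq> 0}"

definition zeros :: "nat \<Rightarrow> (nat \<Rightarrow> 'v set) \<Rightarrow> ('v, complex) upoly \<Rightarrow> (nat \<times> 'v \<Rightarrow> complex) set" where
  "zeros n A p = {u \<in> multiproj n A. peval p u = 0}"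

definition zariski_closure ::
  "nat \<Rightarrow> (nat \<Rightarrow> 'v set) \<Rightarrow> (nat \<times> 'v \<Rightarrow> complex) set \<Rightarrow> (nat \<times> 'v \<Rightarrow> complex) set" where
  "zariski_closure n A S =
    multiproj n A \<inter> \<Inter>{zeros n A p | p. multiform n A p \<and> S \<subseteq> zeros n A p}"

text \<open>\<open>\<T>\<^sub>N = Hom(M, \<complex>\<^sup>\<times>)\<close>; the character \<open>\<chi>\<^sup>a\<close> is evaluation at \<open>a\<close>.\<close>

definition torus :: "'v::ab_group_add set \<Rightarrow> ('v \<Rightarrow> complex) set" where
  "torus M = {\<xi> \<in> M \<rightarrow>\<^sub>E (UNIV - {0}). \<forall>x\<in>M. \<forall>y\<in>M. \<xi> (x + y) = \<xi> x * \<xi> y}"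

definition incidence ::
  "'v::ab_group_add set \<Rightarrow> nat \<Rightarrow> (nat \<Rightarrow> 'v set) \<Rightarrow> (('v \<Rightarrow> complex) \<times> (nat \<times> 'v \<Rightarrow> complex)) set" where
  "incidence M n A =
    {(\<xi>, u). \<xi> \<in> torus M \<and> u \<in> multiproj n A \<and> (\<forall>i\<le>n. (\<Sum>a\<in>A i. u (i, a) * \<xi> a) = 0)}"

definition incidence_image ::
  "'v::ab_group_add set \<Rightarrow> nat \<Rightarrow> (nat \<Rightarrow> 'v set) \<Rightarrow> (nat \<times> 'v \<Rightarrow> complex) set" where
  "incidence_image M n A = zariski_closure n A (snd ` incidence M n A)"

text \<open>The degree of the projection from the incidence variety onto the closure of its image: the
  number of points of a general fibre, that is, of the fibre over every point of some nonempty
  open subset (we are over \<open>\<complex>\<close>, so this is the degree of the extension of function fields).\<close>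

definition projection_degree :: "'v::ab_group_add set \<Rightarrow> nat \<Rightarrow> (nat \<Rightarrow> 'v set) \<Rightarrow> nat \<Rightarrow> bool" where
  "projection_degree M n A d \<longleftrightarrow>
    (\<exists>q. multiform n A q \<and> \<not> incidence_image M n A \<subseteq> zeros n A q \<and>
      (\<forall>u \<in> incidence_image M n A - zeros n A q.
         finite {\<xi>. (\<xi>, u) \<in> incidence M n A} \<and> card {\<xi>. (\<xi>, u) \<in> incidence M n A} = d))"

text \<open>\<open>P\<close> is a reduced equation of the closure of the image, which is therefore a hypersurface.\<close>

definition image_equation :: "'v::ab_group_add set \<Rightarrow> nat \<Rightarrow> (nat \<Rightarrow> 'v set) \<Rightarrow> ('v, complex) upoly \<Rightarrow> bool" where
  "image_equation M n A P \<longleftrightarrow>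
    irreducible P \<and> multiform n A P \<and>
    incidence_image M n A \<noteq> {} \<and> zeros n A P = incidence_image M n A"

text \<open>The direct image of the incidence variety is its degree over the image times the closure of
  the image if the latter is a hypersurface, and the zero divisor otherwise. A multiform defines
  the divisor of \<open>P ^ d\<close> if it differs from \<open>P ^ d\<close> by a factor \<open>g\<close> without zeros in
  \<open>\<Prod>\<^sub>i \<P>\<^sup>A\<^sup>i\<close>. Such a \<open>g\<close> is a nonzero constant if every \<open>A i\<close> has at least two elements; if
  \<open>A i = {a}\<close>, then \<open>\<P>\<^sup>A\<^sup>i\<close> is a point and powers of \<open>u\<^sub>i\<^sub>,\<^sub>a\<close> may also occur in \<open>g\<close>.\<close>

definition defines_direct_image ::
  "'v::ab_group_add set \<Rightarrow> nat \<Rightarrow> (nat \<Rightarrow> 'v set) \<Rightarrow> ('v, complex) upoly \<Rightarrow> bool" where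
  "defines_direct_image M n A R \<longleftrightarrow>
    (if \<exists>P. image_equation M n A P
     then \<exists>P d g. image_equation M n A P \<and> projection_degree M n A d \<and>
            multiform n A g \<and> zeros n A g = {} \<and> R = g * P ^ d
     else zeros n A R = {})"

text \<open>The resultant is determined only up to sign, hence a predicate.\<close>

definition sparse_resultant :: "'v::ab_group_add set \<Rightarrow> nat \<Rightarrow> (nat \<Rightarrow> 'v set) \<Rightarrow> ('v, int) upoly \<Rightarrow> bool" where
  "sparse_resultant M n A R \<longleftrightarrow>
    multiform n A R \<and> primitive R \<and> defines_direct_image M n A (complexify R)"


section \<open>Coherent mixed subdivisions\<close>

text \<open>Addition and sums of sets are Minkowski sums.\<close>

definition minkowski_polytope :: "nat \<Rightarrow> (nat \<Rightarrow> 'v::real_vector set) \<Rightarrow> 'v set" where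
  "minkowski_polytope n A = (\<Sum>i\<le>n. convex hull (A i))"

definition lifted_polytope :: "'v::real_vector set \<Rightarrow> ('v \<Rightarrow> real) \<Rightarrow> ('v \<times> real) set" where
  "lifted_polytope S r = convex hull ((\<lambda>a. (a, r a)) ` S)"

text \<open>The projection to \<open>M\<^sub>\<real>\<close> of the lower face, selected by the functional \<open>(v, 1)\<close>, of the lifted
  polytope of \<open>S\<close>.\<close>

definition lower_cell :: "'v::real_vector set \<Rightarrow> ('v \<Rightarrow> real) \<Rightarrow> ('v \<Rightarrow> real) \<Rightarrow> 'v set" where
  "lower_cell S r v =
    fst ` {p \<in> lifted_polytope S r. \<forall>q \<in> lifted_polytope S r. v (fst p) + snd p \<le> v (fst q) + snd q}"

text \<open>The lower faces of the sum of the lifted polytopes are the sums of the lower faces of the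
  summands for the same functional. A cell is represented by the family of its components.\<close>

definition cells :: "nat \<Rightarrow> (nat \<Rightarrow> 'v::real_vector set) \<Rightarrow> (nat \<Rightarrow> 'v \<Rightarrow> real) \<Rightarrow> (nat \<Rightarrow> 'v set) set" where
  "cells n A \<rho> = {(\<lambda>i\<in>{..n}. lower_cell (A i) (\<rho> i) v) | v. linear v}"

definition cell_set :: "nat \<Rightarrow> (nat \<Rightarrow> 'v::real_vector set) \<Rightarrow> 'v set" where
  "cell_set n D = (\<Sum>i\<le>n. D i)"

definition cdim :: "'v::real_vector set \<Rightarrow> nat" where
  "cdim S = dim {x - y | x y. x \<in> S \<and> y \<in> S}"

definition full_cells :: "nat \<Rightarrow> (nat \<Rightarrow> 'v::real_vector set) \<Rightarrow> (nat \<Rightarrow> 'v \<Rightarrow> real) \<Rightarrow> (nat \<Rightarrow> 'v set) set" where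
  "full_cells n A \<rho> = {D \<in> cells n A \<rho>. cdim (cell_set n D) = n}"

definition tight :: "nat \<Rightarrow> (nat \<Rightarrow> 'v::real_vector set) \<Rightarrow> (nat \<Rightarrow> 'v \<Rightarrow> real) \<Rightarrow> bool" where
  "tight n A \<rho> \<longleftrightarrow> (\<forall>D\<in>full_cells n A \<rho>. (\<Sum>i\<le>n. cdim (D i)) = n)"

definition mixed_cell :: "nat \<Rightarrow> (nat \<Rightarrow> 'v::real_vector set) \<Rightarrow> bool" where
  "mixed_cell n D \<longleftrightarrow> (\<exists>!i. i \<le> n \<and> cdim (D i) = 0)"

definition in_translated_cell :: "nat \<Rightarrow> 'v::real_normed_vector \<Rightarrow> 'v \<Rightarrow> (nat \<Rightarrow> 'v set) \<Rightarrow> bool" where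
  "in_translated_cell n \<delta> b D \<longleftrightarrow> b \<in> interior ((+) \<delta> ` cell_set n D)"

definition lattice_points :: "'v::real_vector set \<Rightarrow> nat \<Rightarrow> (nat \<Rightarrow> 'v set) \<Rightarrow> 'v \<Rightarrow> 'v set" where
  "lattice_points M n A \<delta> = (+) \<delta> ` minkowski_polytope n A \<inter> M"

definition generic_shift ::
  "'v::real_normed_vector set \<Rightarrow> nat \<Rightarrow> (nat \<Rightarrow> 'v set) \<Rightarrow> (nat \<Rightarrow> 'v \<Rightarrow> real) \<Rightarrow> 'v \<Rightarrow> bool" where
  "generic_shift M n A \<rho> \<delta> \<longleftrightarrow>
    (\<forall>b\<in>lattice_points M n A \<delta>. \<exists>D\<in>full_cells n A \<rho>. in_translated_cell n \<delta> b D)"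

text \<open>Distinct \<open>n\<close>-cells have disjoint interiors, so the cell of a point is unique.\<close>

definition cell_of ::
  "nat \<Rightarrow> (nat \<Rightarrow> 'v::real_normed_vector set) \<Rightarrow> (nat \<Rightarrow> 'v \<Rightarrow> real) \<Rightarrow> 'v \<Rightarrow> 'v \<Rightarrow> (nat \<Rightarrow> 'v set)" where
  "cell_of n A \<rho> \<delta> b = (THE D. D \<in> full_cells n A \<rho> \<and> in_translated_cell n \<delta> b D)"

definition row_index ::
  "nat \<Rightarrow> (nat \<Rightarrow> 'v::real_normed_vector set) \<Rightarrow> (nat \<Rightarrow> 'v \<Rightarrow> real) \<Rightarrow> 'v \<Rightarrow> 'v \<Rightarrow> nat" where
  "row_index n A \<rho> \<delta> b = Max {i. i \<le> n \<and> cdim (cell_of n A \<rho> \<delta> b i) = 0}"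

definition row_point ::
  "nat \<Rightarrow> (nat \<Rightarrow> 'v::real_normed_vector set) \<Rightarrow> (nat \<Rightarrow> 'v \<Rightarrow> real) \<Rightarrow> 'v \<Rightarrow> 'v \<Rightarrow> 'v" where
  "row_point n A \<rho> \<delta> b = the_elem (cell_of n A \<rho> \<delta> b (row_index n A \<rho> \<delta> b))"

definition mixed_points ::
  "'v::real_normed_vector set \<Rightarrow> nat \<Rightarrow> (nat \<Rightarrow> 'v set) \<Rightarrow> (nat \<Rightarrow> 'v \<Rightarrow> real) \<Rightarrow> 'v \<Rightarrow> 'v set" where
  "mixed_points M n A \<rho> \<delta> = {b \<in> lattice_points M n A \<delta>. mixed_cell n (cell_of n A \<rho> \<delta> b)}"

definition nonmixed_points ::
  "'v::real_normed_vector set \<Rightarrow> nat \<Rightarrow> (nat \<Rightarrow> 'v set) \<Rightarrow> (nat \<Rightarrow> 'v \<Rightarrow> real) \<Rightarrow> 'v \<Rightarrow> 'v set" where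
  "nonmixed_points M n A \<rho> \<delta> = {b \<in> lattice_points M n A \<delta>. \<not> mixed_cell n (cell_of n A \<rho> \<delta> b)}"


section \<open>Canny--Emiris matrices and the greedy algorithm\<close>

definition CE_entry ::
  "nat \<Rightarrow> (nat \<Rightarrow> 'v::real_normed_vector set) \<Rightarrow> (nat \<Rightarrow> 'v \<Rightarrow> real) \<Rightarrow> 'v \<Rightarrow> 'v \<Rightarrow> 'v \<Rightarrow> ('v, int) upoly" where
  "CE_entry n A \<rho> \<delta> b b' =
    (let i = row_index n A \<rho> \<delta> b; a = b' - b + row_point n A \<rho> \<delta> b
     in if a \<in> A i then uvar i a else 0)"

text \<open>The determinant of a matrix whose rows and columns are indexed by a finite set; with
  \<open>I \<subseteq> J\<close>, the principal submatrix of a matrix on \<open>J\<close> indexed by \<open>I\<close> has determinant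
  \<open>det_on I\<close>.\<close>

definition det_on :: "'i set \<Rightarrow> ('i \<Rightarrow> 'i \<Rightarrow> 'a::comm_ring_1) \<Rightarrow> 'a" where
  "det_on I H = (\<Sum>p | p permutes I. of_int (sign p) * (\<Prod>i\<in>I. H i (p i)))"

lemma det_on_UNIV: "det_on UNIV (\<lambda>i j. H $ i $ j) = det H"
  by (simp add: det_on_def det_def)

inductive_set greedy ::
  "'v::real_normed_vector set \<Rightarrow> nat \<Rightarrow> (nat \<Rightarrow> 'v set) \<Rightarrow> (nat \<Rightarrow> 'v \<Rightarrow> real) \<Rightarrow> 'v \<Rightarrow> 'v set"
  for M n A \<rho> \<delta> where
  start: "b \<in> mixed_points M n A \<rho> \<delta> \<Longrightarrow> b \<in> greedy M n A \<rho> \<delta>"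
| step: "b \<in> greedy M n A \<rho> \<delta> \<Longrightarrow> a \<in> A (row_index n A \<rho> \<delta> b) \<Longrightarrow>
    b - row_point n A \<rho> \<delta> b + a \<in> greedy M n A \<rho> \<delta>"

end

theory Submission
  imports Defs
begin

text \<open>A row of the Canny--Emiris matrix indexed by a point of the greedy set \<open>\<G>\<close> vanishes outside the
  columns indexed by \<open>\<G>\<close>, so both determinants are block triangular with respect to \<open>\<G>\<close> and its
  complement. All points in mixed cells belong to \<open>\<G>\<close>, hence the complementary blocks of numerator
  and denominator are the same and cancel. That \<open>\<G>\<close> stays inside \<open>\<B>\<close> is because the component
  \<open>D\<^sub>i\<^sub>(\<^sub>b\<^sub>)\<close> of the cell of \<open>b\<close> is a single point of \<open>\<A>\<^sub>i\<^sub>(\<^sub>b\<^sub>)\<close>, which may be replaced by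
  any other point of \<open>\<A>\<^sub>i\<^sub>(\<^sub>b\<^sub>)\<close> without leaving the translated Minkowski sum.\<close>

section \<open>Polynomial rings without zero divisors\<close>

text \<open>The convolution sum for the coefficient at \<open>a + b\<close> collapses to one term.
  Below, \<open>a\<close> and \<open>b\<close> are leading exponents, so a product of nonzero
  leading coefficients survives.\<close>

lemma lookup_mult_unique_decomposition:
  fixes f g :: "'a::monoid_add \<Rightarrow>\<^sub>0 'b::semiring_0"
  assumes "\<And>k l. k \<in> Poly_Mapping.keys f \<Longrightarrow> l \<in> Poly_Mapping.keys g \<Longrightarrow> k + l = a + b \<Longrightarrow> k = a \<and> l = b"
  shows "Poly_Mapping.lookup (f * g) (a + b) = Poly_Mapping.lookup f a * Poly_Mapping.lookup g b"
proof -
  let ?h = "\<lambda>(k, l). Poly_Mapping.lookup f k * Poly_Mapping.lookup g l when a + b = k + l"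
  have "Poly_Mapping.lookup (f * g) (a + b) = Sum_any ?h"
    unfolding times_poly_mapping.rep_eq by (rule prod_fun_unfold_prod) simp_all
  also have "\<dots> = sum ?h {(a, b)}"
  proof (rule Sum_any.expand_superset)
    show "{kl. ?h kl \<noteq> 0} \<subseteq> {(a, b)}"
    proof
      fix kl assume "kl \<in> {kl. ?h kl \<noteq> 0}"
      then obtain k l where "kl = (k, l)" "a + b = k + l"
        "Poly_Mapping.lookup f k * Poly_Mapping.lookup g l \<noteq> 0"
        by (cases kl) (auto simp: when_def split: if_splits)
      then show "kl \<in> {(a, b)}"
        using assms[of k l] by (metis in_keys_iff mult_zero_left mult_zero_right singletonI)
    qed
  qed simp
  finally show ?thesis by simp
qed

text \<open>The library proves this only for linearly ordered monoids of exponents. Here the finitely many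
  variables that occur are numbered, which embeds the exponents that matter into such a monoid.\<close>

lemma polynomial_no_zero_divisors:
  fixes p q :: "('a \<Rightarrow>\<^sub>0 nat) \<Rightarrow>\<^sub>0 'c::semiring_no_zero_divisors"
  assumes "p \<noteq> 0" "q \<noteq> 0"
  shows "p * q \<noteq> 0"
proof -
  define V where "V = (\<Union>m \<in> Poly_Mapping.keys p \<union> Poly_Mapping.keys q. Poly_Mapping.keys m)"
  have "finite V" by (simp add: V_def)
  then obtain f :: "'a \<Rightarrow> nat" where f: "inj_on f V"
    using finite_imp_inj_to_nat_seg by blast
  \<comment> \<open>\<open>w\<close> renames variables along \<open>f\<close>. It is additive, and
    on exponents supported in \<open>V\<close> it is injective, so the linear order on its values
    picks out leading exponents.\<close>
  define w :: "('a \<Rightarrow>\<^sub>0 nat) \<Rightarrow> (nat \<Rightarrow>\<^sub>0 nat)"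
    where "w m = (\<Sum>x\<in>V. Poly_Mapping.single (f x) (Poly_Mapping.lookup m x))" for m
  have w_add: "w (k + l) = w k + w l" for k l
    by (simp add: w_def lookup_add single_add sum.distrib)
  have w_lookup: "Poly_Mapping.lookup (w m) (f x) = Poly_Mapping.lookup m x" if "x \<in> V" for m x
  proof -
    have "Poly_Mapping.lookup (w m) (f x)
        = (\<Sum>y\<in>V. if y = x then Poly_Mapping.lookup m x else 0)"
      unfolding w_def lookup_sum
      by (rule sum.cong[OF refl]) (use f that in \<open>auto simp: lookup_single when_def inj_on_def\<close>)
    also have "\<dots> = Poly_Mapping.lookup m x"
      using \<open>finite V\<close> that by simp
    finally show ?thesis .
  qed
  have w_inj: "k = l" if "w k = w l" "Poly_Mapping.keys k \<subseteq> V" "Poly_Mapping.keys l \<subseteq> V" for k l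
  proof (rule poly_mapping_eqI)
    fix x
    show "Poly_Mapping.lookup k x = Poly_Mapping.lookup l x"
    proof (cases "x \<in> V")
      case True
      then show ?thesis using w_lookup[OF True, of k] w_lookup[OF True, of l] that(1) by simp
    next
      case False
      then have "x \<notin> Poly_Mapping.keys k" "x \<notin> Poly_Mapping.keys l" using that by auto
      then show ?thesis by (simp add: in_keys_iff)
    qed
  qed
  have keys_V: "Poly_Mapping.keys m \<subseteq> V" if "m \<in> Poly_Mapping.keys p \<union> Poly_Mapping.keys q" for m
    using that by (auto simp: V_def)
  have lead: "\<exists>a\<in>Poly_Mapping.keys r. \<forall>k\<in>Poly_Mapping.keys r. w k \<le> w a"
    if "r \<noteq> 0" for r :: "('a \<Rightarrow>\<^sub>0 nat) \<Rightarrow>\<^sub>0 'c"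
  proof -
    have "Poly_Mapping.keys r \<noteq> {}"
      using that by (metis poly_mapping_eqI in_keys_iff empty_iff lookup_zero)
    then have "Max (w ` Poly_Mapping.keys r) \<in> w ` Poly_Mapping.keys r" by simp
    then obtain a where "a \<in> Poly_Mapping.keys r" "Max (w ` Poly_Mapping.keys r) = w a" by auto
    then show ?thesis by (metis Max_ge finite_imageI finite_keys imageI)
  qed
  obtain a where a: "a \<in> Poly_Mapping.keys p" "\<And>k. k \<in> Poly_Mapping.keys p \<Longrightarrow> w k \<le> w a"
    using lead[OF assms(1)] by blast
  obtain b where b: "b \<in> Poly_Mapping.keys q" "\<And>k. k \<in> Poly_Mapping.keys q \<Longrightarrow> w k \<le> w b"
    using lead[OF assms(2)] by blast
  \<comment> \<open>If \<open>w k\<close> dropped below \<open>w a\<close>, the other factor would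
    have to exceed \<open>w b\<close>, which is maximal on the support of \<open>q\<close>.\<close>
  have "k = a \<and> l = b"
    if "k \<in> Poly_Mapping.keys p" "l \<in> Poly_Mapping.keys q" "k + l = a + b" for k l
  proof -
    have eq: "w k + w l = w a + w b" using that(3) by (metis w_add)
    have "w k = w a"
    proof (rule ccontr)
      assume "w k \<noteq> w a"
      then have "w k < w a" using a(2)[OF that(1)] by simp
      then have "w k + w l < w a + w b" using b(2)[OF that(2)] by (rule add_less_le_mono)
      then show False using eq by simp
    qed
    with eq have "w l = w b" by simp
    with \<open>w k = w a\<close> show ?thesis
      using that(1,2) a(1) b(1) by (auto intro!: w_inj keys_V)
  qed
  then have "Poly_Mapping.lookup (p * q) (a + b) = Poly_Mapping.lookup p a * Poly_Mapping.lookup q b"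
    by (rule lookup_mult_unique_decomposition)
  also have "\<dots> \<noteq> 0" using a(1) b(1) by (simp add: in_keys_iff)
  finally show ?thesis by auto
qed

section \<open>Determinants indexed by sets\<close>

text \<open>The transpositions that swap one fixed element with each element of \<open>S\<close>
  already form an infinite family. Hence \<open>det_on\<close> over an infinite set is a sum over an
  infinite index set, which is 0 by convention.\<close>

lemma infinite_permutations:
  assumes "infinite S"
  shows "infinite {p. p permutes S}"
proof
  assume fin: "finite {p. p permutes S}"
  obtain a where a: "a \<in> S" using assms by (metis finite.emptyI ex_in_conv)
  have "(\<lambda>b. Transposition.transpose a b) ` S \<subseteq> {p. p permutes S}"
    using a by (auto intro: permutes_swap_id)
  moreover have "inj_on (\<lambda>b. Transposition.transpose a b) S"
    by (rule inj_onI) (metis transpose_apply_first)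
  ultimately show False using fin assms by (metis finite_imageD finite_subset)
qed

lemma det_on_infinite: "infinite S \<Longrightarrow> det_on S H = 0"
  by (simp add: det_on_def infinite_permutations)

text \<open>Only permutations preserving \<open>G\<close> contribute to the Leibniz sum. They
  correspond to pairs of permutations of \<open>G\<close> and of \<open>S - G\<close>, and signs and
  products of entries multiply.\<close>

lemma det_on_block_triangular:
  fixes H :: "'i \<Rightarrow> 'i \<Rightarrow> 'a::comm_ring_1"
  assumes "finite S" "G \<subseteq> S" and zero: "\<And>i j. i \<in> G \<Longrightarrow> j \<in> S - G \<Longrightarrow> H i j = 0"
  shows "det_on S H = det_on G H * det_on (S - G) H"
proof -
  let ?t = "\<lambda>I p. of_int (sign p) * (\<Prod>i\<in>I. H i (p i)) :: 'a"
  let ?P = "{p. p permutes S \<and> p ` G = G}"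
  have fin: "finite G" "finite (S - G)" using assms finite_subset by auto
  have "det_on S H = sum (?t S) ?P"
    unfolding det_on_def
  proof (rule sum.mono_neutral_right)
    show "\<forall>p\<in>{p. p permutes S} - ?P. ?t S p = 0"
    proof
      fix p assume "p \<in> {p. p permutes S} - ?P"
      then have p: "p permutes S" "p ` G \<noteq> G" by auto
      \<comment> \<open>An injective map of the finite set \<open>G\<close> into itself would be
        onto, so some row of \<open>G\<close> is sent to a column outside \<open>G\<close>, where
        the entry is zero.\<close>
      then have "\<not> p ` G \<subseteq> G"
        using fin(1) permutes_inj_on[OF p(1), of G] by (metis card_image card_subset_eq)
      then obtain i where "i \<in> G" "p i \<notin> G" by auto
      moreover have "p i \<in> S" using \<open>i \<in> G\<close> assms(2) permutes_in_image[OF p(1)] by auto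
      ultimately have "H i (p i) = 0" using zero by auto
      moreover have "i \<in> S" using \<open>i \<in> G\<close> assms(2) by auto
      ultimately have "(\<Prod>i\<in>S. H i (p i)) = 0"
        using assms(1) by (meson prod_zero)
      then show "?t S p = 0" by simp
    qed
  qed (use assms(1) finite_permutations in auto)
  \<comment> \<open>\<open>restrict_id\<close> is the identity off the given set, so both
    restrictions are permutations of the whole type and their composite recovers
    \<open>p\<close>.\<close>
  also have "\<dots> = (\<Sum>(p1, p2)\<in>{p. p permutes G} \<times> {p. p permutes S - G}. ?t G p1 * ?t (S - G) p2)"
  proof (rule sum.reindex_bij_witness
      [where i = "\<lambda>(p1, p2). p1 \<circ> p2" and j = "\<lambda>p. (restrict_id p G, restrict_id p (S - G))"])
    fix p assume "p \<in> ?P"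
    then have p: "p permutes S" "p ` G = G" by auto
    have bij: "bij p" using p permutes_bij by blast
    have pSG: "p ` (S - G) = S - G"
      using p permutes_image[OF p(1)] by (simp add: image_set_diff permutes_inj)
    have 1: "restrict_id p G permutes G" "restrict_id p (S - G) permutes S - G"
      using bij p(2) pSG by (auto intro!: permutes_restrict_id simp: bij_betw_def inj_on_subset[OF bij_is_inj])
    then show "(restrict_id p G, restrict_id p (S - G)) \<in> {p. p permutes G} \<times> {p. p permutes S - G}"
      by simp
    have comp: "restrict_id p G \<circ> restrict_id p (S - G) = p"
    proof
      fix x
      show "(restrict_id p G \<circ> restrict_id p (S - G)) x = p x"
      proof (cases "x \<in> S - G")
        case True
        then have "p x \<in> S - G" using pSG by blast
        then show ?thesis using True by (simp add: restrict_id_def)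
      next
        case False
        then show ?thesis using p(1) assms(2) by (auto simp: restrict_id_def permutes_not_in)
      qed
    qed
    then show "(case (restrict_id p G, restrict_id p (S - G)) of (p1, p2) \<Rightarrow> p1 \<circ> p2) = p"
      by simp
    have "sign p = sign (restrict_id p G) * sign (restrict_id p (S - G))"
      using sign_compose[of "restrict_id p G" "restrict_id p (S - G)"] 1 fin comp
        permutation_permutes by metis
    moreover have "(\<Prod>i\<in>S. H i (p i))
        = (\<Prod>i\<in>G. H i (restrict_id p G i)) * (\<Prod>i\<in>S - G. H i (restrict_id p (S - G) i))"
      using prod.subset_diff[OF assms(2,1), of "\<lambda>i. H i (p i)"]
      by (simp add: restrict_id_def mult.commute)
    ultimately show "(case (restrict_id p G, restrict_id p (S - G)) of
        (p1, p2) \<Rightarrow> ?t G p1 * ?t (S - G) p2) = ?t S p"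
      by (simp add: mult_ac)
  next
    fix pp assume "pp \<in> {p. p permutes G} \<times> {p. p permutes S - G}"
    then obtain p1 p2 where pp: "pp = (p1, p2)" and p1: "p1 permutes G" and p2: "p2 permutes S - G"
      by auto
    have on_G: "(p1 \<circ> p2) x = p1 x" if "x \<in> G" for x
      using that permutes_not_in[OF p2] by auto
    have off_G: "(p1 \<circ> p2) x = p2 x" if "x \<notin> G" for x
    proof -
      have "p2 x \<notin> G"
        using that permutes_in_image[OF p2, of x] permutes_not_in[OF p2, of x] by auto
      then show ?thesis using permutes_not_in[OF p1] by simp
    qed
    have "p1 \<circ> p2 permutes S"
      using permutes_compose[OF permutes_subset[OF p2] permutes_subset[OF p1]] assms(2) by auto
    moreover have "(p1 \<circ> p2) ` G = G"
      using on_G permutes_image[OF p1] by (metis image_cong)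
    ultimately show "(case pp of (p1, p2) \<Rightarrow> p1 \<circ> p2) \<in> ?P" by (simp add: pp)
    have "restrict_id (p1 \<circ> p2) G = p1"
      using on_G permutes_not_in[OF p1] by (auto simp: restrict_id_def fun_eq_iff)
    moreover have "restrict_id (p1 \<circ> p2) (S - G) = p2"
      using off_G permutes_not_in[OF p2] by (auto simp: restrict_id_def fun_eq_iff)
    ultimately show "(restrict_id (case pp of (p1, p2) \<Rightarrow> p1 \<circ> p2) G,
        restrict_id (case pp of (p1, p2) \<Rightarrow> p1 \<circ> p2) (S - G)) = pp"
      by (simp add: pp)
  qed
  also have "\<dots> = det_on G H * det_on (S - G) H"
    unfolding det_on_def sum_product sum.cartesian_product ..
  finally show ?thesis .
qed

section \<open>Lower faces and cells of the mixed subdivision\<close>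

lemma in_cell_setE:
  assumes "x \<in> cell_set n D"
  obtains d where "x = (\<Sum>i\<le>n. d i)" "\<And>i. i \<le> n \<Longrightarrow> d i \<in> D i"
  using assms unfolding cell_set_def by (auto simp: set_sum_alt)

lemma in_cell_setI: "(\<And>i. i \<le> n \<Longrightarrow> d i \<in> D i) \<Longrightarrow> (\<Sum>i\<le>n. d i) \<in> cell_set n D"
  unfolding cell_set_def by (auto simp: set_sum_alt)

text \<open>This is the support function of the lifted polytope, with a minimum in place of a
  maximum, in the direction \<open>(v, 1)\<close>.\<close>

definition lower_value :: "'v::real_vector set \<Rightarrow> ('v \<Rightarrow> real) \<Rightarrow> ('v \<Rightarrow> real) \<Rightarrow> real" where
  "lower_value S r v = (INF q\<in>lifted_polytope S r. v (fst q) + snd q)"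

text \<open>A point of the lower cell attains the infimum, so the values are bounded below and the
  conditional \<open>INF\<close> behaves as expected.\<close>

lemma lower_value_le:
  assumes "lower_cell S r v \<noteq> {}" "q \<in> lifted_polytope S r"
  shows "lower_value S r v \<le> v (fst q) + snd q"
proof -
  obtain p where "p \<in> lifted_polytope S r"
    "\<forall>q\<in>lifted_polytope S r. v (fst p) + snd p \<le> v (fst q) + snd q"
    using assms(1) by (auto simp: lower_cell_def)
  then show ?thesis
    unfolding lower_value_def using assms(2) by (intro cINF_lower bdd_belowI2) auto
qed

lemma lower_cellE:
  assumes "x \<in> lower_cell S r v"
  obtains s where "(x, s) \<in> lifted_polytope S r" "v x + s = lower_value S r v"
proof -
  obtain s where s: "(x, s) \<in> lifted_polytope S r"
    "\<forall>q\<in>lifted_polytope S r. v x + s \<le> v (fst q) + snd q"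
    using assms by (auto simp: lower_cell_def)
  then have "lower_value S r v = v x + s"
    unfolding lower_value_def by (intro cInf_eq_minimum) force+
  with s(1) that show thesis by simp
qed

text \<open>On a cell with functional \<open>v\<close> the lower envelope of the sum of the lifted polytopes is a
  constant minus \<open>v\<close>, and everywhere it is at least that.\<close>

lemma functional_difference_le:
  assumes v: "linear v" and v': "linear v'"
    and "x \<in> cell_set n (\<lambda>i. lower_cell (A i) (\<rho> i) v)"
    and "x \<in> cell_set n (\<lambda>i. lower_cell (A i) (\<rho> i) v')"
  shows "v x - v' x \<le> (\<Sum>i\<le>n. lower_value (A i) (\<rho> i) v) - (\<Sum>i\<le>n. lower_value (A i) (\<rho> i) v')"
proof -
  obtain d where x: "x = (\<Sum>i\<le>n. d i)" and d: "\<And>i. i \<le> n \<Longrightarrow> d i \<in> lower_cell (A i) (\<rho> i) v"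
    using assms(3) by (rule in_cell_setE) blast
  \<comment> \<open>The points \<open>d' i\<close> witness that the lower cells for
    \<open>v'\<close> are nonempty, as \<open>lower_value_le\<close> requires.\<close>
  obtain d' where d': "\<And>i. i \<le> n \<Longrightarrow> d' i \<in> lower_cell (A i) (\<rho> i) v'"
    using assms(4) by (rule in_cell_setE) blast
  have "v (d i) - v' (d i) \<le> lower_value (A i) (\<rho> i) v - lower_value (A i) (\<rho> i) v'"
    if i: "i \<le> n" for i
  proof -
    obtain s where s: "(d i, s) \<in> lifted_polytope (A i) (\<rho> i)"
      "v (d i) + s = lower_value (A i) (\<rho> i) v"
      using d[OF i] by (rule lower_cellE)
    have "lower_value (A i) (\<rho> i) v' \<le> v' (d i) + s"
      using lower_value_le[OF _ s(1), of v'] d'[OF i] by auto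
    with s(2) show ?thesis by simp
  qed
  then have "(\<Sum>i\<le>n. v (d i) - v' (d i)) \<le> (\<Sum>i\<le>n. lower_value (A i) (\<rho> i) v - lower_value (A i) (\<rho> i) v')"
    by (intro sum_mono) simp
  then show ?thesis
    by (simp add: x linear_sum[OF v] linear_sum[OF v'] sum_subtractf)
qed

lemma linear_eq_0_if_constant_on_open:
  fixes w :: "'v::real_normed_vector \<Rightarrow> real"
  assumes "linear w" "open U" "b \<in> U" and const: "\<And>x. x \<in> U \<Longrightarrow> w x = w b"
  shows "w u = 0"
proof -
  obtain e where e: "e > 0" "ball b e \<subseteq> U" using assms by (meson openE)
  \<comment> \<open>Adding 1 keeps the denominator positive for \<open>u = 0\<close> and makes
    \<open>t * norm u\<close> strictly less than \<open>e\<close>.\<close>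
  define t where "t = e / (norm u + 1)"
  have pos: "norm u + 1 > 0" by (simp add: add_nonneg_pos)
  then have t: "t > 0" using e(1) by (simp add: t_def)
  have "t * norm u < e"
    using e(1) pos by (simp add: t_def field_simps)
  then have "b + t *\<^sub>R u \<in> ball b e" using t by (simp add: dist_norm)
  then have "w (b + t *\<^sub>R u) = w b" using const e(2) by auto
  then show ?thesis
    using t by (simp add: linear_add[OF assms(1)] linear_scale[OF assms(1)])
qed

text \<open>Comparing the two functionals in both directions shows that \<open>v - v'\<close> is
  constant on the overlap of the interiors. This overlap is open and contains \<open>b\<close>, so
  \<open>v = v'\<close>, and the functional determines all components of the cell.\<close>

lemma cell_unique:
  assumes "D \<in> cells n A \<rho>" "D' \<in> cells n A \<rho>"
    and "in_translated_cell n \<delta> b D" "in_translated_cell n \<delta> b D'"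
  shows "D = D'"
proof -
  obtain v where v: "linear v" "D = (\<lambda>i\<in>{..n}. lower_cell (A i) (\<rho> i) v)"
    using assms(1) by (auto simp: cells_def)
  obtain v' where v': "linear v'" "D' = (\<lambda>i\<in>{..n}. lower_cell (A i) (\<rho> i) v')"
    using assms(2) by (auto simp: cells_def)
  have sets: "cell_set n D = cell_set n (\<lambda>i. lower_cell (A i) (\<rho> i) v)"
    "cell_set n D' = cell_set n (\<lambda>i. lower_cell (A i) (\<rho> i) v')"
    by (auto simp: cell_set_def v v' intro!: sum.cong)
  let ?c = "(\<Sum>i\<le>n. lower_value (A i) (\<rho> i) v) - (\<Sum>i\<le>n. lower_value (A i) (\<rho> i) v')"
  let ?U = "interior ((+) \<delta> ` cell_set n D) \<inter> interior ((+) \<delta> ` cell_set n D')"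
  let ?w = "\<lambda>x. v x - v' x"
  have lin: "linear ?w" using v(1) v'(1) by (rule linear_compose_sub)
  have w: "?w x = ?w \<delta> + ?c" if x: "x \<in> ?U" for x
  proof -
    have "x \<in> (+) \<delta> ` cell_set n D" "x \<in> (+) \<delta> ` cell_set n D'"
      using x interior_subset by blast+
    then obtain y where y: "x = \<delta> + y" "y \<in> cell_set n D" "y \<in> cell_set n D'" by auto
    then have "?w y \<le> ?c" "- ?w y \<le> - ?c"
      using functional_difference_le[OF v(1) v'(1), of y n A \<rho>]
        functional_difference_le[OF v'(1) v(1), of y n A \<rho>] by (simp_all add: sets)
    moreover have "?w x = ?w \<delta> + ?w y"
      unfolding y(1) by (rule linear_add[OF lin])
    ultimately show ?thesis by simp
  qed
  have b: "b \<in> ?U" using assms(3,4) by (simp add: in_translated_cell_def)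
  have "?w u = 0" for u
  proof (rule linear_eq_0_if_constant_on_open[OF lin _ b])
    show "open ?U" by (intro open_Int open_interior)
    show "?w x = ?w b" if "x \<in> ?U" for x using w[OF that] w[OF b] by simp
  qed
  then have "v = v'" by (simp add: fun_eq_iff)
  then show ?thesis using v v' by simp
qed

lemma cell_of_in_full_cells:
  assumes "generic_shift M n A \<rho> \<delta>" "b \<in> lattice_points M n A \<delta>"
  shows "cell_of n A \<rho> \<delta> b \<in> full_cells n A \<rho>"
    and "in_translated_cell n \<delta> b (cell_of n A \<rho> \<delta> b)"
proof -
  obtain D where "D \<in> full_cells n A \<rho>" "in_translated_cell n \<delta> b D"
    using assms by (auto simp: generic_shift_def)
  then have "\<exists>!D. D \<in> full_cells n A \<rho> \<and> in_translated_cell n \<delta> b D"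
    using cell_unique unfolding full_cells_def by blast
  from theI'[OF this]
  show "cell_of n A \<rho> \<delta> b \<in> full_cells n A \<rho>"
    and "in_translated_cell n \<delta> b (cell_of n A \<rho> \<delta> b)"
    unfolding cell_of_def by auto
qed

lemma lower_cell_subset_convex_hull: "lower_cell S r v \<subseteq> convex hull S"
proof -
  have "fst ` lifted_polytope S r = convex hull S"
    unfolding lifted_polytope_def
    by (simp add: convex_hull_linear_image[OF linear_fst] image_image)
  then show ?thesis by (auto simp: lower_cell_def)
qed

text \<open>A linear functional on a convex hull attains its minimum at a generator. This identifies
  a component consisting of a single point with an element of the support.\<close>

lemma lower_cell_meets_support:
  assumes v: "linear v" and "finite S" "lower_cell S r v \<noteq> {}"
  obtains a where "a \<in> S" "a \<in> lower_cell S r v"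
proof -
  have "S \<noteq> {}" using assms(3) by (auto simp: lower_cell_def lifted_polytope_def)
  then obtain a where a: "a \<in> S" "\<And>x. x \<in> S \<Longrightarrow> v a + r a \<le> v x + r x"
    using arg_min_if_finite[OF assms(2), of "\<lambda>x. v x + r x"] by (metis not_le)
  let ?l = "\<lambda>q::'a \<times> real. v (fst q) + snd q"
  have lin: "linear ?l"
    by (intro linear_compose_add linear_snd linear_compose[OF linear_fst v, unfolded o_def])
  have "convex {q. v a + r a \<le> ?l q}"
    using convex_linear_vimage[OF lin, of "{v a + r a..}"] by (simp add: vimage_def)
  then have "lifted_polytope S r \<subseteq> {q. v a + r a \<le> ?l q}"
    unfolding lifted_polytope_def using a(2) by (intro hull_minimal) auto
  moreover have "(a, r a) \<in> lifted_polytope S r"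
    using a(1) by (simp add: lifted_polytope_def hull_inc)
  ultimately have "a \<in> lower_cell S r v"
    unfolding lower_cell_def by (force simp: image_iff)
  with a(1) show thesis by (rule that)
qed

text \<open>\<open>dim\<close> is \<open>0\<close> also for spaces of infinite dimension, hence the finite spanning set.\<close>

lemma singleton_if_cdim_0:
  fixes S :: "'v::real_vector set"
  assumes "finite E" "span E = (UNIV :: 'v set)" and "cdim S = 0" and "x \<in> S" "y \<in> S"
  shows "x = y"
proof -
  let ?V = "{x - y | x y. x \<in> S \<and> y \<in> S}"
  obtain B where B: "B \<subseteq> ?V" "independent B" "?V \<subseteq> span B" "card B = dim ?V"
    by (rule basis_exists)
  have "finite B" using independent_span_bound[OF assms(1) B(2)] assms(2) by auto
  then have "B = {}" using B(4) assms(3) by (simp add: cdim_def)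
  then have "?V \<subseteq> {0}" using B(3) by simp
  then show ?thesis using assms(4,5) by force
qed

section \<open>The greedy set and its rows\<close>

lemma lattice_of_rank_closed:
  assumes "lattice_of_rank n M" "x \<in> M" "y \<in> M"
  shows "x + y \<in> M" "x - y \<in> M"
proof -
  obtain E where E: "M = range (\<lambda>c::'a \<Rightarrow> int. \<Sum>e\<in>E. of_int (c e) *\<^sub>R e)"
    using assms(1) by (auto simp: lattice_of_rank_def)
  obtain c d :: "'a \<Rightarrow> int" where xy: "x = (\<Sum>e\<in>E. of_int (c e) *\<^sub>R e)" "y = (\<Sum>e\<in>E. of_int (d e) *\<^sub>R e)"
    using assms(2,3) by (auto simp: E)
  have "x + y = (\<Sum>e\<in>E. of_int (c e + d e) *\<^sub>R e)" "x - y = (\<Sum>e\<in>E. of_int (c e - d e) *\<^sub>R e)"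
    by (simp_all add: xy sum.distrib sum_subtractf algebra_simps)
  then show "x + y \<in> M" "x - y \<in> M"
    by (auto simp: E intro: range_eqI[of _ _ "\<lambda>e. c e + d e"] range_eqI[of _ _ "\<lambda>e. c e - d e"])
qed

lemma greedy_step_in_lattice_points:
  assumes M: "lattice_of_rank n M"
    and A: "\<forall>i\<le>n. finite (A i) \<and> A i \<subseteq> M"
    and "tight n A \<rho>" "generic_shift M n A \<rho> \<delta>"
    and b: "b \<in> lattice_points M n A \<delta>"
    and a: "a \<in> A (row_index n A \<rho> \<delta> b)"
  shows "b - row_point n A \<rho> \<delta> b + a \<in> lattice_points M n A \<delta>"
proof -
  obtain E where E: "finite E" "span E = (UNIV :: 'a set)"
    using M by (auto simp: lattice_of_rank_def)
  define D where "D = cell_of n A \<rho> \<delta> b"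
  define k where "k = row_index n A \<rho> \<delta> b"
  have full: "D \<in> full_cells n A \<rho>" and trans: "in_translated_cell n \<delta> b D"
    using cell_of_in_full_cells[OF assms(4) b] by (simp_all add: D_def)
  obtain v where v: "linear v" "D = (\<lambda>i\<in>{..n}. lower_cell (A i) (\<rho> i) v)"
    using full by (auto simp: full_cells_def cells_def)
  \<comment> \<open>There are \<open>n + 1\<close> components. If all had positive dimension, the
    dimensions would sum to at least \<open>n + 1\<close>, contradicting tightness. So the maximum
    in \<open>row_index\<close> is over a nonempty set.\<close>
  have "\<exists>i\<le>n. cdim (D i) = 0"
  proof (rule ccontr)
    assume "\<not> ?thesis"
    then have "(\<Sum>i\<le>n. 1) \<le> (\<Sum>i\<le>n. cdim (D i))"
      by (intro sum_mono) (auto simp: Suc_le_eq)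
    then show False using assms(3) full by (simp add: tight_def)
  qed
  then have "k \<in> {i. i \<le> n \<and> cdim (D i) = 0}"
    unfolding k_def row_index_def D_def[symmetric] by (intro Max_in) auto
  then have k: "k \<le> n" "cdim (D k) = 0" by auto
  have "b \<in> (+) \<delta> ` cell_set n D"
    using trans interior_subset by (auto simp: in_translated_cell_def)
  then obtain d where b_eq: "b = \<delta> + (\<Sum>i\<le>n. d i)" and d: "\<And>i. i \<le> n \<Longrightarrow> d i \<in> D i"
    by (auto elim!: in_cell_setE)
  have "D k \<noteq> {}" using d[OF k(1)] by auto
  then obtain c where c: "c \<in> A k" "c \<in> D k"
    using lower_cell_meets_support[OF v(1), of "A k" "\<rho> k"] A k(1) v(2) by auto
  have "D k = {c}"
    using singleton_if_cdim_0[OF E k(2) _ c(2)] c(2) by blast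
  then have rp: "row_point n A \<rho> \<delta> b = c" and dk: "d k = c"
    using d[OF k(1)] by (simp_all add: row_point_def D_def k_def)
  have a': "a \<in> A k" using a by (simp add: k_def)
  \<comment> \<open>The summand at \<open>k\<close> is forced to be \<open>c\<close>, so one greedy
    step exchanges it for \<open>a\<close> and leaves all other summands in place.\<close>
  have "(\<Sum>i\<le>n. (d(k := a)) i) = (\<Sum>i\<le>n. d i) - c + a"
    using k(1) dk by (simp add: sum.remove[of "{..n}" k])
  then have eq: "b - c + a = \<delta> + (\<Sum>i\<le>n. (d(k := a)) i)"
    by (simp add: b_eq)
  have "(d(k := a)) i \<in> convex hull (A i)" if "i \<le> n" for i
    using a' d[OF that] lower_cell_subset_convex_hull[of "A i" "\<rho> i" v] that v(2)
    by (auto simp: hull_inc)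
  then have "(\<Sum>i\<le>n. (d(k := a)) i) \<in> cell_set n (\<lambda>i. convex hull (A i))"
    by (rule in_cell_setI)
  moreover have "b - c + a \<in> M"
    using b c(1) a' A k(1) lattice_of_rank_closed[OF M] by (auto simp: lattice_points_def subset_iff)
  ultimately show ?thesis
    unfolding rp eq lattice_points_def minkowski_polytope_def cell_set_def by simp
qed

lemma greedy_subset_lattice_points:
  assumes "lattice_of_rank n M" "\<forall>i\<le>n. finite (A i) \<and> A i \<subseteq> M"
    and "tight n A \<rho>" "generic_shift M n A \<rho> \<delta>"
  shows "greedy M n A \<rho> \<delta> \<subseteq> lattice_points M n A \<delta>"
proof
  fix b assume "b \<in> greedy M n A \<rho> \<delta>"
  then show "b \<in> lattice_points M n A \<delta>"
  proof induction
    case (start b)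
    then show ?case by (simp add: mixed_points_def)
  next
    case (step b a)
    then show ?case using greedy_step_in_lattice_points[OF assms] by blast
  qed
qed

text \<open>A nonzero entry puts \<open>b'\<close> in the form
  \<open>b - row_point n A \<rho> \<delta> b + a\<close> with \<open>a\<close> in the support of the
  row, which is exactly a point added by \<open>greedy.step\<close>.\<close>

lemma CE_entry_leaving_greedy:
  assumes "b \<in> greedy M n A \<rho> \<delta>" "b' \<notin> greedy M n A \<rho> \<delta>"
  shows "CE_entry n A \<rho> \<delta> b b' = 0"
proof (rule ccontr)
  assume "CE_entry n A \<rho> \<delta> b b' \<noteq> 0"
  then have "b' - b + row_point n A \<rho> \<delta> b \<in> A (row_index n A \<rho> \<delta> b)"
    by (auto simp: CE_entry_def Let_def split: if_splits)
  from greedy.step[OF assms(1) this] assms(2) show False by simp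
qed

section \<open>Cancellation of the common diagonal block\<close>

theorem theorem1p16:
  fixes M :: "'v::real_normed_vector set" and n :: nat
    and A :: "nat \<Rightarrow> 'v set" and \<rho> :: "nat \<Rightarrow> 'v \<Rightarrow> real" and \<delta> :: 'v
    and Res :: "('v, int) upoly"
  assumes "lattice_of_rank n M"
    and "\<forall>i\<le>n. finite (A i) \<and> A i \<subseteq> M"
    and "sparse_resultant M n A Res"
    and "tight n A \<rho>"
    and "generic_shift M n A \<rho> \<delta>"
    and "equals_quotient Res
           (det_on (lattice_points M n A \<delta>) (CE_entry n A \<rho> \<delta>))
           (det_on (nonmixed_points M n A \<rho> \<delta>) (CE_entry n A \<rho> \<delta>))"
  shows "equals_quotient Res
           (det_on (greedy M n A \<rho> \<delta>) (CE_entry n A \<rho> \<delta>))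
           (det_on (greedy M n A \<rho> \<delta> \<inter> nonmixed_points M n A \<rho> \<delta>) (CE_entry n A \<rho> \<delta>))"
proof -
  let ?B = "lattice_points M n A \<delta>" and ?N = "nonmixed_points M n A \<rho> \<delta>"
  let ?G = "greedy M n A \<rho> \<delta>" and ?H = "CE_entry n A \<rho> \<delta>"
  have E0: "det_on ?N ?H \<noteq> 0" and HRE: "det_on ?B ?H = Res * det_on ?N ?H"
    using assms(6) by (auto simp: equals_quotient_def)
  \<comment> \<open>The coefficients of the zero polynomial have \<open>Gcd\<close> 0, so it is not
    primitive.\<close>
  have "Res \<noteq> 0" using assms(3) by (auto simp: sparse_resultant_def primitive_def)
  then have "det_on ?B ?H \<noteq> 0" using E0 HRE polynomial_no_zero_divisors by metis
  \<comment> \<open>An infinite index set has determinant \<open>0\<close>, so finiteness of \<open>\<B>\<close> needs no compactness.\<close>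
  then have fin: "finite ?B" using det_on_infinite by blast
  have N: "?N \<subseteq> ?B" by (auto simp: nonmixed_points_def)
  have "?B - ?N \<subseteq> ?G"
    by (auto simp: nonmixed_points_def mixed_points_def intro: greedy.start)
  then have rest: "?N - ?G \<inter> ?N = ?B - ?G" using N by blast
  have H: "det_on ?B ?H = det_on ?G ?H * det_on (?B - ?G) ?H"
    using greedy_subset_lattice_points[OF assms(1,2,4,5)] fin
    by (intro det_on_block_triangular) (auto intro: CE_entry_leaving_greedy)
  \<comment> \<open>An index in \<open>?N\<close> outside \<open>?G \<inter> ?N\<close> lies outside
    \<open>?G\<close>, so the vanishing of entries that leave the greedy set applies here
    too.\<close>
  have "det_on ?N ?H = det_on (?G \<inter> ?N) ?H * det_on (?N - ?G \<inter> ?N) ?H"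
    using fin N finite_subset
    by (intro det_on_block_triangular) (auto intro: CE_entry_leaving_greedy)
  then have E: "det_on ?N ?H = det_on (?G \<inter> ?N) ?H * det_on (?B - ?G) ?H"
    unfolding rest .
  \<comment> \<open>Both factorizations share the block on \<open>?B - ?G\<close>. It divides the
    nonzero denominator, so it is nonzero and can be cancelled.\<close>
  have "(det_on ?G ?H - Res * det_on (?G \<inter> ?N) ?H) * det_on (?B - ?G) ?H = 0"
    using HRE unfolding H E by (simp add: algebra_simps)
  moreover have "det_on (?B - ?G) ?H \<noteq> 0" using E0 E by auto
  ultimately have "det_on ?G ?H - Res * det_on (?G \<inter> ?N) ?H = 0"
    using polynomial_no_zero_divisors by metis
  moreover have "det_on (?G \<inter> ?N) ?H \<noteq> 0" using E0 E by auto
  ultimately show ?thesis by (simp add: equals_quotient_def)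
qed

end
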